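(* Let $\{K;f_1,\dots,f_N\}$ be a self-similar structure with surjection $\pi_K:\{1,\dots,N\}^{\mathbb N}\to K$, let $F(C)=\bigcup_{j=1}^N f_j(C)$ for $C\subset K$, let $$S=\{x\in K:\ \exists x'\in K,\ i\neq j\in\{1,\dots,N\},\ f_i(x)=f_j(x')\},$$ and assume there exists $X_0\subset K$ such that (A) $X_0$ is a nonempty compact set, (B) $X_0\supset S$, (C) $X_0\subset F(X_0)$. Set $Y=\{1,\dots,N\}$ and $X_1=F(X_0)$, and consider the similarity scheme $X_0\xrightarrow{\varphi}X_1\xleftarrow{\pi}Y\times X_0$, where $\varphi$ is the inclusion and $\pi(j,x)=f_j(x)$. Let $\mathcal R$ be the relation on $Y^{\mathbb N}$ associated with this scheme and let $\mathcal R'$ be the relation on $Y^{\mathbb N}$ given by $I\,\mathcal R'\,J$ iff $\pi_K(I)=\pi_K(J)$. Then $\mathcal R=\mathcal R'$, the similarity scheme is fully injective, and $K=X_\infty$ (that is, $K$ and $X_\infty$ are identified as quotients of $Y^{\mathbb N}$: there is a homeomorphism $h:X_\infty\to K$ with $h\circ\pi^{\mathbb N}=\pi_K$).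
   Context: Self-similar structure $\{K;f_1,\dots,f_N\}$: $K$ is a compact Hausdorff space, $f_1,\dots,f_N:K\to K$ are continuous injective maps, and there is a continuous surjection $\pi_K:\{1,\dots,N\}^{\mathbb N}\to K$ (product topology) with $\pi_K\circ W_k=f_k\circ\pi_K$ for all $k$, where $W_k(y_1,y_2,\dots)=(k,y_1,y_2,\dots)$. Similarity scheme. A similarity scheme $X_0\xrightarrow{\varphi}X_1\xleftarrow{\pi}Y\times X_0$ consists of compact Hausdorff spaces $X_0,X_1,Y$, a continuous injective map $\varphi:X_0\to X_1$ and a continuous surjective map $\pi:Y\times X_0\to X_1$. Tower. Put $\varphi_{1,0}=\varphi$, $\pi_{1,0}=\pi$. Inductively, for $n\ge1$, let $X_{n+1}=(Y\times X_n)/\sim$ (quotient topology; it is compact Hausdorff), where $(y,z)\sim(y',z')$ iff either $(y,z)=(y',z')$ or there are $x_0,x_0'\in X_0$ with $z=\varphi_{n,0}(x_0)$, $z'=\varphi_{n,0}(x_0')$, $\pi(y,x_0)=\pi(y',x_0')$; let $\pi_{1,n}:Y\times X_n\to X_{n+1}$ be the quotient map, and let $\varphi_{n+1,n}:X_n\to X_{n+1}$ be the (well-defined, continuous, injective) map with $\varphi_{n+1,n}(\pi_{1,n-1}(y,x))=\pi_{1,n}(y,\varphi_{n,n-1}(x))$. For $n\ge m$, $\varphi_{n,m}:X_m\to X_n$ is the composite $\varphi_{n,n-1}\circ\cdots\circ\varphi_{m+1,m}$ ($\varphi_{n,n}=\mathrm{id}$). Define $\pi_{p,q}:Y^p\times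 X_q\to X_{p+q}$ by $\pi_{0,q}=\mathrm{id}$ and $\pi_{p,q}=\pi_{p-1,q+1}\circ(\mathrm{id}_{Y^{p-1}}\times\pi_{1,q})$ for $p\ge1$. Limit space. For $(y_1,\dots,y_p)\in Y^p$ the cell is $C(y_1,\dots,y_p)=\{\pi_{p,0}(y_1,\dots,y_p,x):x\in X_0\}\subset X_p$ (for $p=0$ it is $X_0$). For $x_n\in X_n$, $\Gamma_n(x_n)=\{(y_1,y_2,\dots)\in Y^{\mathbb N}:\varphi_{p,n}(x_n)\in C(y_1,\dots,y_p)\ \forall p\ge n\}$ (a nonempty closed set). The relation $\mathcal R$ on $Y^{\mathbb N}$: $u\,\mathcal R\,v$ iff $u=v$ or there are $n\ge0$ and $x_n\in X_n$ with $u,v\in\Gamma_n(x_n)$. $\mathcal R_\infty$ is the smallest equivalence relation containing $\mathcal R$; $X_\infty=Y^{\mathbb N}/\mathcal R_\infty$ has the quotient topology and $\pi^{\mathbb N}:Y^{\mathbb N}\to X_\infty$ is the quotient map. $\varphi_{\infty,n}:X_n\to X_\infty$ sends $x_n$ to the unique element of $\pi^{\mathbb N}(\Gamma_n(x_n))$. The scheme is fully injective if all $\varphi_{\infty,n}$, $n\ge0$, are injective. *)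

theory Defs
  imports "HOL-Analysis.Analysis"
begin

definition quotient_topology :: "('a \<Rightarrow> 'b) \<Rightarrow> 'a topology \<Rightarrow> 'b topology" where
  "quotient_topology q T =
     topology (\<lambda>U. U \<subseteq> q ` topspace T \<and> openin T {x \<in> topspace T. q x \<in> U})"

lemma openin_quotient_topology:
  "openin (quotient_topology q T) U \<longleftrightarrow>
     U \<subseteq> q ` topspace T \<and> openin T {x \<in> topspace T. q x \<in> U}"
proof -
  have "istopology (\<lambda>U. U \<subseteq> q ` topspace T \<and> openin T {x \<in> topspace T. q x \<in> U})"
    unfolding istopology_def
  proof (intro conjI allI impI)
    fix A B
    assume A: "A \<subseteq> q ` topspace T \<and> openin T {x \<in> topspace T. q x \<in> A}"
      and B: "B \<subseteq> q ` topspace T \<and> openin T {x \<in> topspace T. q x \<in> B}"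
    show "A \<inter> B \<subseteq> q ` topspace T" using A by blast
    have "{x \<in> topspace T. q x \<in> A \<inter> B}
        = {x \<in> topspace T. q x \<in> A} \<inter> {x \<in> topspace T. q x \<in> B}" by blast
    then show "openin T {x \<in> topspace T. q x \<in> A \<inter> B}"
      using A B by (simp only: openin_Int)
  next
    fix \<K>
    assume K: "\<forall>U\<in>\<K>. U \<subseteq> q ` topspace T \<and> openin T {x \<in> topspace T. q x \<in> U}"
    show "\<Union>\<K> \<subseteq> q ` topspace T" using K by blast
    have "{x \<in> topspace T. q x \<in> \<Union>\<K>} = (\<Union>U\<in>\<K>. {x \<in> topspace T. q x \<in> U})" by blast
    then show "openin T {x \<in> topspace T. q x \<in> \<Union>\<K>}" using K by auto
  qed
  then show ?thesis
    unfolding quotient_topology_def by (simp add: topology_inverse')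
qed

lemma topspace_quotient_topology [simp]:
  "topspace (quotient_topology q T) = q ` topspace T"
proof
  show "topspace (quotient_topology q T) \<subseteq> q ` topspace T"
    using openin_topspace[of "quotient_topology q T"]
    unfolding openin_quotient_topology by (rule conjunct1)
  have "{x \<in> topspace T. q x \<in> q ` topspace T} = topspace T" by blast
  then have "openin (quotient_topology q T) (q ` topspace T)"
    by (simp add: openin_quotient_topology)
  then show "q ` topspace T \<subseteq> topspace (quotient_topology q T)"
    by (rule openin_subset)
qed

lemma quotient_map_quotient_topology: "quotient_map T (quotient_topology q T) q"
  by (auto simp: quotient_map_def openin_quotient_topology)

record ('a, 'b, 'y) simscheme =
  sch_X0 :: "'a topology"
  sch_X1 :: "'b topology"
  sch_Y :: "'y topology"
  sch_phi :: "'a \<Rightarrow> 'b"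
  sch_pi :: "'y \<times> 'a \<Rightarrow> 'b"

definition similarity_scheme :: "('a, 'b, 'y) simscheme \<Rightarrow> bool" where
  "similarity_scheme \<S> \<longleftrightarrow>
     compact_space (sch_X0 \<S>) \<and> Hausdorff_space (sch_X0 \<S>) \<and>
     compact_space (sch_X1 \<S>) \<and> Hausdorff_space (sch_X1 \<S>) \<and>
     compact_space (sch_Y \<S>) \<and> Hausdorff_space (sch_Y \<S>) \<and>
     continuous_map (sch_X0 \<S>) (sch_X1 \<S>) (sch_phi \<S>) \<and>
     inj_on (sch_phi \<S>) (topspace (sch_X0 \<S>)) \<and>
     continuous_map (prod_topology (sch_Y \<S>) (sch_X0 \<S>)) (sch_X1 \<S>) (sch_pi \<S>) \<and>
     sch_pi \<S> ` (topspace (sch_Y \<S>) \<times> topspace (sch_X0 \<S>)) = topspace (sch_X1 \<S>)"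

text \<open>
  All spaces of the tower live on one type of points: \<open>Pt0\<close> and \<open>Pt1\<close> embed the points of
  \<open>X\<^sub>0\<close> and \<open>X\<^sub>1\<close>, and the points of \<open>X\<^bsub>n+1\<^esub>\<close>, \<open>n \<ge> 1\<close>, are the equivalence classes of
  \<open>\<sim>\<close> on \<open>Y \<times> X\<^sub>n\<close>.  As no HOL type contains all its own subsets, a class \<open>c\<close> is
  recorded as \<open>Cls p\<close> for a fixed (chosen) member \<open>p\<close> of \<open>c\<close>; by the lemma
  \<open>class_pt_eq_iff\<close> below this names the classes injectively.
\<close>

datatype ('a, 'b, 'y) pt = Pt0 (un_Pt0: 'a) | Pt1 'b | Cls "'y \<times> ('a, 'b, 'y) pt"

definition class_pt :: "('y \<times> ('a, 'b, 'y) pt) set \<Rightarrow> ('a, 'b, 'y) pt" where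
  "class_pt c = Cls (SOME p. p \<in> c)"

lemma class_pt_eq_iff:
  assumes "equiv A E" "p \<in> A" "q \<in> A"
  shows "class_pt (E `` {p}) = class_pt (E `` {q}) \<longleftrightarrow> (p, q) \<in> E"
proof
  let ?r = "SOME r. r \<in> E `` {p}" and ?s = "SOME r. r \<in> E `` {q}"
  assume eq: "class_pt (E `` {p}) = class_pt (E `` {q})"
  have "?r \<in> E `` {p}" by (rule someI[of _ p]) (rule equiv_class_self[OF assms(1,2)])
  moreover have "?s \<in> E `` {q}" by (rule someI[of _ q]) (rule equiv_class_self[OF assms(1,3)])
  moreover have "?r = ?s" using eq unfolding class_pt_def pt.inject .
  ultimately have "(p, ?r) \<in> E" "(q, ?r) \<in> E" by simp_all
  then show "(p, q) \<in> E"
    using assms(1) unfolding equiv_def by (meson symD transD)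
next
  assume "(p, q) \<in> E"
  then show "class_pt (E `` {p}) = class_pt (E `` {q})"
    by (simp add: equiv_class_eq[OF assms(1)])
qed

text \<open>
  \<open>tower \<S> n\<close> is \<open>X\<^sub>n\<close>, \<open>tsim \<S> n\<close> is the relation \<open>\<sim>\<close> on \<open>Y \<times> X\<^sub>n\<close> (\<open>n \<ge> 1\<close>), \<open>tpi \<S> n\<close> is
  \<open>\<pi>\<^bsub>1,n\<^esub>\<close>, \<open>tphi \<S> n\<close> is \<open>\<phi>\<^bsub>n+1,n\<^esub>\<close> and \<open>tphis \<S> n m\<close> is \<open>\<phi>\<^bsub>n,m\<^esub>\<close> (meaningful for \<open>n \<ge> m\<close>).
\<close>

function (sequential)
      tower :: "('a, 'b, 'y) simscheme \<Rightarrow> nat \<Rightarrow> ('a, 'b, 'y) pt topology"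
  and tsim :: "('a, 'b, 'y) simscheme \<Rightarrow> nat \<Rightarrow>
                 (('y \<times> ('a, 'b, 'y) pt) \<times> ('y \<times> ('a, 'b, 'y) pt)) set"
  and tpi :: "('a, 'b, 'y) simscheme \<Rightarrow> nat \<Rightarrow> 'y \<times> ('a, 'b, 'y) pt \<Rightarrow> ('a, 'b, 'y) pt"
  and tphi :: "('a, 'b, 'y) simscheme \<Rightarrow> nat \<Rightarrow> ('a, 'b, 'y) pt \<Rightarrow> ('a, 'b, 'y) pt"
  and tphis :: "('a, 'b, 'y) simscheme \<Rightarrow> nat \<Rightarrow> nat \<Rightarrow> ('a, 'b, 'y) pt \<Rightarrow> ('a, 'b, 'y) pt"
where
  "tower \<S> 0 = quotient_topology Pt0 (sch_X0 \<S>)"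
| "tower \<S> (Suc 0) = quotient_topology Pt1 (sch_X1 \<S>)"
| "tower \<S> (Suc (Suc n)) =
     quotient_topology (tpi \<S> (Suc n)) (prod_topology (sch_Y \<S>) (tower \<S> (Suc n)))"
| "tsim \<S> n =
     {((y, z), (y', z')).
        y \<in> topspace (sch_Y \<S>) \<and> z \<in> topspace (tower \<S> n) \<and>
        y' \<in> topspace (sch_Y \<S>) \<and> z' \<in> topspace (tower \<S> n) \<and>
        ((y, z) = (y', z') \<or>
         (\<exists>x\<in>topspace (sch_X0 \<S>). \<exists>x'\<in>topspace (sch_X0 \<S>).
            z = tphis \<S> n 0 (Pt0 x) \<and> z' = tphis \<S> n 0 (Pt0 x') \<and>
            sch_pi \<S> (y, x) = sch_pi \<S> (y', x')))}"
| "tpi \<S> 0 = (\<lambda>(y, z). Pt1 (sch_pi \<S> (y, un_Pt0 z)))"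
| "tpi \<S> (Suc n) = (\<lambda>p. class_pt (tsim \<S> (Suc n) `` {p}))"
| "tphi \<S> 0 = (\<lambda>z. Pt1 (sch_phi \<S> (un_Pt0 z)))"
| "tphi \<S> (Suc n) =
     (\<lambda>w. THE v. \<exists>y\<in>topspace (sch_Y \<S>). \<exists>x\<in>topspace (tower \<S> n).
        w = tpi \<S> n (y, x) \<and> v = tpi \<S> (Suc n) (y, tphi \<S> n x))"
| "tphis \<S> 0 m = id"
| "tphis \<S> (Suc n) m = (if m \<le> n then tphi \<S> n \<circ> tphis \<S> n m else id)"
  by pat_completeness auto
termination
  by (relation "Wellfounded.measure (\<lambda>t. case t of
        Inl (Inl (_, n)) \<Rightarrow> 4 * n
      | Inl (Inr (_, n)) \<Rightarrow> 4 * n + 1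
      | Inr (Inl (_, n)) \<Rightarrow> 4 * n + 2
      | Inr (Inr (Inl (_, n))) \<Rightarrow> 4 * n + 3
      | Inr (Inr (Inr (_, n, _))) \<Rightarrow> 4 * n)") auto

text \<open>
  \<open>tpis \<S> p q u\<close> is \<open>\<pi>\<^bsub>p,q\<^esub>(y\<^sub>1, \<dots>, y\<^sub>p, _)\<close>, where the word is given by the first \<open>p\<close> entries of
  the sequence \<open>u\<close>, numbered from \<open>0\<close>: \<open>y\<^sub>i = u (i - 1)\<close>.  The same convention is used for cells.
\<close>

primrec tpis :: "('a, 'b, 'y) simscheme \<Rightarrow> nat \<Rightarrow> nat \<Rightarrow> (nat \<Rightarrow> 'y) \<Rightarrow>
    ('a, 'b, 'y) pt \<Rightarrow> ('a, 'b, 'y) pt" where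
  "tpis \<S> 0 = (\<lambda>q u z. z)"
| "tpis \<S> (Suc p) = (\<lambda>q u z. tpis \<S> p (Suc q) u (tpi \<S> q (u p, z)))"

definition cell :: "('a, 'b, 'y) simscheme \<Rightarrow> nat \<Rightarrow> (nat \<Rightarrow> 'y) \<Rightarrow> ('a, 'b, 'y) pt set" where
  "cell \<S> p u = tpis \<S> p 0 u ` topspace (tower \<S> 0)"

definition seq_space :: "'y topology \<Rightarrow> (nat \<Rightarrow> 'y) topology" where
  "seq_space Y = product_topology (\<lambda>_. Y) UNIV"

definition Gam :: "('a, 'b, 'y) simscheme \<Rightarrow> nat \<Rightarrow> ('a, 'b, 'y) pt \<Rightarrow> (nat \<Rightarrow> 'y) set" where
  "Gam \<S> n z =
     {u \<in> topspace (seq_space (sch_Y \<S>)). \<forall>p\<ge>n. tphis \<S> p n z \<in> cell \<S> p u}"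

definition scheme_rel :: "('a, 'b, 'y) simscheme \<Rightarrow> ((nat \<Rightarrow> 'y) \<times> (nat \<Rightarrow> 'y)) set" where
  "scheme_rel \<S> =
     {(u, v). u \<in> topspace (seq_space (sch_Y \<S>)) \<and> v \<in> topspace (seq_space (sch_Y \<S>)) \<and>
        (u = v \<or> (\<exists>n. \<exists>z\<in>topspace (tower \<S> n). u \<in> Gam \<S> n z \<and> v \<in> Gam \<S> n z))}"

definition scheme_rel_inf :: "('a, 'b, 'y) simscheme \<Rightarrow> ((nat \<Rightarrow> 'y) \<times> (nat \<Rightarrow> 'y)) set" where
  "scheme_rel_inf \<S> =
     \<Inter> {E. equiv (topspace (seq_space (sch_Y \<S>))) E \<and> scheme_rel \<S> \<subseteq> E}"

definition pi_seq :: "('a, 'b, 'y) simscheme \<Rightarrow> (nat \<Rightarrow> 'y) \<Rightarrow> (nat \<Rightarrow> 'y) set" where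
  "pi_seq \<S> u = scheme_rel_inf \<S> `` {u}"

definition X_inf :: "('a, 'b, 'y) simscheme \<Rightarrow> (nat \<Rightarrow> 'y) set topology" where
  "X_inf \<S> = quotient_topology (pi_seq \<S>) (seq_space (sch_Y \<S>))"

definition phi_inf :: "('a, 'b, 'y) simscheme \<Rightarrow> nat \<Rightarrow> ('a, 'b, 'y) pt \<Rightarrow> (nat \<Rightarrow> 'y) set" where
  "phi_inf \<S> n z = the_elem (pi_seq \<S> ` Gam \<S> n z)"

definition fully_injective :: "('a, 'b, 'y) simscheme \<Rightarrow> bool" where
  "fully_injective \<S> \<longleftrightarrow> (\<forall>n. inj_on (phi_inf \<S> n) (topspace (tower \<S> n)))"

definition self_similar_structure ::
    "'k topology \<Rightarrow> nat \<Rightarrow> (nat \<Rightarrow> 'k \<Rightarrow> 'k) \<Rightarrow> ((nat \<Rightarrow> nat) \<Rightarrow> 'k) \<Rightarrow> bool" where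
  "self_similar_structure K N f \<pi>K \<longleftrightarrow>
     compact_space K \<and> Hausdorff_space K \<and>
     (\<forall>k\<in>{1..N}. continuous_map K K (f k) \<and> inj_on (f k) (topspace K)) \<and>
     continuous_map (seq_space (discrete_topology {1..N})) K \<pi>K \<and>
     \<pi>K ` topspace (seq_space (discrete_topology {1..N})) = topspace K \<and>
     (\<forall>k\<in>{1..N}. \<forall>u\<in>topspace (seq_space (discrete_topology {1..N})).
        \<pi>K (case_nat k u) = f k (\<pi>K u))"

definition hutchinson :: "nat \<Rightarrow> (nat \<Rightarrow> 'k \<Rightarrow> 'k) \<Rightarrow> 'k set \<Rightarrow> 'k set" where
  "hutchinson N f C = (\<Union>j\<in>{1..N}. f j ` C)"

definition overlap_set :: "'k topology \<Rightarrow> nat \<Rightarrow> (nat \<Rightarrow> 'k \<Rightarrow> 'k) \<Rightarrow> 'k set" where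
  "overlap_set K N f =
     {x \<in> topspace K. \<exists>x'\<in>topspace K. \<exists>i\<in>{1..N}. \<exists>j\<in>{1..N}. i \<noteq> j \<and> f i x = f j x'}"

definition sss_scheme ::
    "'k topology \<Rightarrow> nat \<Rightarrow> (nat \<Rightarrow> 'k \<Rightarrow> 'k) \<Rightarrow> 'k set \<Rightarrow> ('k, 'k, nat) simscheme" where
  "sss_scheme K N f X0 =
     \<lparr> sch_X0 = subtopology K X0,
       sch_X1 = subtopology K (hutchinson N f X0),
       sch_Y = discrete_topology {1..N},
       sch_phi = (\<lambda>x. x),
       sch_pi = (\<lambda>(j, x). f j x) \<rparr>"

end

theory Submission
  imports Defs
begin

text \<open>
  Sending the class of \<open>(y, z)\<close> to \<open>f\<^sub>y\<close> of the point of \<open>K\<close> represented by \<open>z\<close> identifies \<open>X\<^sub>n\<close>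
  with \<open>F\<^sup>n(X\<^sub>0) \<subseteq> K\<close>, and all \<open>\<phi>\<^bsub>n,m\<^esub>\<close> with inclusions: two points of \<open>Y \<times> X\<^sub>n\<close> with different
  first components that have the same image in \<open>K\<close> come from \<open>S \<subseteq> X\<^sub>0\<close>, so they are glued by \<open>\<sim>\<close>.
  Under this identification \<open>\<Gamma>\<^sub>n(x)\<close> is the fibre of \<open>\<pi>\<^sub>K\<close> over \<open>x\<close>: if \<open>x = f\<^bsub>u|p\<^esub>(a)\<close> lies in
  \<open>F\<^sup>p(X\<^sub>0)\<close>, then peeling off one letter at a time, either the letters agree or the
  remaining point is in \<open>S \<subseteq> X\<^sub>0\<close>, whence \<open>a \<in> X\<^sub>0\<close>.  Finally, if two distinct sequences have the same
  image in \<open>K\<close>, then cutting them just after the first difference shows that this image lies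
  in some \<open>F\<^sup>n(X\<^sub>0)\<close>.
\<close>

section \<open>Evaluating tower points and words in the space\<close>

fun pt_eval :: "('y \<Rightarrow> 'k \<Rightarrow> 'k) \<Rightarrow> ('k, 'k, 'y) pt \<Rightarrow> 'k" where
  "pt_eval f (Pt0 x) = x"
| "pt_eval f (Pt1 x) = x"
| "pt_eval f (Cls (y, z)) = f y (pt_eval f z)"

text \<open>The composite of \<open>f (u 0)\<close>, ..., \<open>f (u (p - 1))\<close>, innermost
  letter \<open>u (p - 1)\<close>. The recursion strips the last letter first, exactly as
  \<open>tpis\<close> does, so the two can be compared by a direct induction.\<close>

primrec word_map :: "('y \<Rightarrow> 'k \<Rightarrow> 'k) \<Rightarrow> nat \<Rightarrow> (nat \<Rightarrow> 'y) \<Rightarrow> 'k \<Rightarrow> 'k" where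
  "word_map f 0 u x = x"
| "word_map f (Suc p) u x = word_map f p u (f (u p) x)"

text \<open>Stripping the outermost letter instead suits inductions over iterates of
  \<open>hutchinson\<close>, whose outermost layer is the first letter.\<close>

lemma word_map_Suc_shift: "word_map f (Suc p) u x = f (u 0) (word_map f p (\<lambda>i. u (Suc i)) x)"
  by (induction p arbitrary: x) auto

lemma word_map_cong: "(\<And>i. i < p \<Longrightarrow> u i = v i) \<Longrightarrow> word_map f p u x = word_map f p v x"
  by (induction p arbitrary: x) auto

section \<open>Two facts about product topologies\<close>

lemma continuous_map_prod_discrete:
  assumes "\<And>j. j \<in> I \<Longrightarrow> continuous_map T U (g j)"
  shows "continuous_map (prod_topology (discrete_topology I) T) U (\<lambda>(j, x). g j x)"
  unfolding continuous_map_def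
proof (intro conjI allI impI)
  show "(\<lambda>(j, x). g j x) \<in> topspace (prod_topology (discrete_topology I) T) \<rightarrow> topspace U"
    using assms by (auto simp: continuous_map_def)
  fix V assume V: "openin U V"
  have "{p \<in> topspace (prod_topology (discrete_topology I) T). (case p of (j, x) \<Rightarrow> g j x) \<in> V}
      = (\<Union>j\<in>I. {j} \<times> {x \<in> topspace T. g j x \<in> V})" by auto
  moreover have "openin (prod_topology (discrete_topology I) T) ({j} \<times> {x \<in> topspace T. g j x \<in> V})"
    if "j \<in> I" for j
    using that openin_continuous_map_preimage[OF assms[OF that] V]
    by (auto simp: openin_prod_Times_iff)
  ultimately show "openin (prod_topology (discrete_topology I) T)
      {p \<in> topspace (prod_topology (discrete_topology I) T). (case p of (j, x) \<Rightarrow> g j x) \<in> V}"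
    by auto
qed

lemma topspace_seq_space: "topspace (seq_space Y) = {u. \<forall>i. u i \<in> topspace Y}"
  by (auto simp: seq_space_def PiE_def Pi_def)

lemma limitin_seq_space_agreeing_prefixes:
  assumes "u \<in> topspace (seq_space Y)" "\<And>p. v p \<in> topspace (seq_space Y)"
    and "\<And>p i. i < p \<Longrightarrow> v p i = u i"
  shows "limitin (seq_space Y) v u sequentially"
  unfolding seq_space_def limitin_componentwise
proof (intro conjI ballI)
  show "\<forall>\<^sub>F p in sequentially. v p \<in> topspace (product_topology (\<lambda>_. Y) UNIV)"
    using assms(2) by (simp add: seq_space_def)
  fix i
  have "\<forall>\<^sub>F p in sequentially. v p i = u i"
    using eventually_gt_at_top[of i] by eventually_elim (rule assms(3))
  then show "limitin Y (\<lambda>p. v p i) (u i) sequentially"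
    using assms(1) by (auto simp: limitin_def topspace_seq_space elim: eventually_mono)
qed simp

section \<open>The self-similar structure and its similarity scheme\<close>

locale sss_tower =
  fixes K :: "'k topology" and N :: nat and f :: "nat \<Rightarrow> 'k \<Rightarrow> 'k"
    and \<pi>K :: "(nat \<Rightarrow> nat) \<Rightarrow> 'k" and X0 :: "'k set"
  assumes sss: "self_similar_structure K N f \<pi>K"
    and compact_X0: "compactin K X0"
    and overlap_subset: "overlap_set K N f \<subseteq> X0"
    and X0_subset: "X0 \<subseteq> hutchinson N f X0"
begin

abbreviation "\<S> \<equiv> sss_scheme K N f X0"
abbreviation "Y \<equiv> {1..N}"
abbreviation "Seq \<equiv> topspace (seq_space (discrete_topology Y))"
abbreviation "X n \<equiv> topspace (tower \<S> n)"
abbreviation "e \<equiv> pt_eval f"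
abbreviation "F \<equiv> hutchinson N f"

declare One_nat_def [simp del] atLeastAtMost_iff [simp del]

lemma F_iff: "x \<in> F C \<longleftrightarrow> (\<exists>y\<in>Y. \<exists>a\<in>C. x = f y a)"
  by (auto simp: hutchinson_def)

lemma X0_subset_K: "X0 \<subseteq> topspace K"
  using compact_X0 by (rule compactin_subset_topspace)

lemma scheme_simps [simp]:
  "topspace (sch_X0 \<S>) = X0" "sch_Y \<S> = discrete_topology Y"
  "sch_pi \<S> (y, x) = f y x" "sch_phi \<S> x = x"
  "sch_X1 \<S> = subtopology K (F X0)"
  using X0_subset_K by (auto simp: sss_scheme_def)

lemma f_cont: "y \<in> Y \<Longrightarrow> continuous_map K K (f y)"
  and f_inj: "y \<in> Y \<Longrightarrow> inj_on (f y) (topspace K)"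
  using sss by (auto simp: self_similar_structure_def)

lemma f_in: "y \<in> Y \<Longrightarrow> x \<in> topspace K \<Longrightarrow> f y x \<in> topspace K"
  using f_cont continuous_map_image_subset_topspace by blast

lemma piK_cont: "continuous_map (seq_space (discrete_topology Y)) K \<pi>K"
  and piK_surj: "\<pi>K ` Seq = topspace K"
  and piK_case_nat: "y \<in> Y \<Longrightarrow> u \<in> Seq \<Longrightarrow> \<pi>K (case_nat y u) = f y (\<pi>K u)"
  and K_Hausdorff: "Hausdorff_space K"
  using sss by (auto simp: self_similar_structure_def)

lemma Seq_iff: "u \<in> Seq \<longleftrightarrow> (\<forall>i. u i \<in> Y)"
  by (simp add: topspace_seq_space)

lemma piK_in: "u \<in> Seq \<Longrightarrow> \<pi>K u \<in> topspace K"
  using piK_surj by blast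

text \<open>Equal letters are handled by injectivity. For different letters the equation is
  symmetric, so both arguments lie in the overlap set. Hypothesis (B) enters the development only
  here.\<close>

lemma f_eq_cases:
  assumes "y \<in> Y" "y' \<in> Y" "x \<in> topspace K" "x' \<in> topspace K" "f y x = f y' x'"
  shows "y = y' \<and> x = x' \<or> x \<in> X0 \<and> x' \<in> X0"
proof (cases "y = y'")
  case True
  then show ?thesis using f_inj[OF assms(1)] assms by (auto dest: inj_onD)
next
  case False
  then have "x \<in> overlap_set K N f" "x' \<in> overlap_set K N f"
    using assms unfolding overlap_set_def by (blast, metis (mono_tags, lifting) mem_Collect_eq)
  then show ?thesis using overlap_subset by blast
qed

lemma F_power_in_K: "(F ^^ n) X0 \<subseteq> topspace K"
  by (induction n) (use X0_subset_K f_in in \<open>auto simp: hutchinson_def\<close>)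

lemma X0_subset_F_power: "X0 \<subseteq> (F ^^ n) X0"
proof (induction n)
  case (Suc n)
  have "F X0 \<subseteq> F ((F ^^ n) X0)" using Suc unfolding hutchinson_def by blast
  then show ?case using X0_subset by auto
qed simp

lemma F_X0: "F X0 \<subseteq> topspace K" "F X0 \<inter> topspace K = F X0"
  using F_power_in_K[of "Suc 0"] by auto

text \<open>(C) is what makes the inclusion a map into \<open>F X0\<close>, which is compact as a
  finite union of continuous images of \<open>X0\<close>.\<close>

lemma scheme_similarity: "similarity_scheme \<S>"
proof -
  have "compactin K (F X0)"
    unfolding hutchinson_def
    by (rule compactin_Union) (auto intro: image_compactin[OF compact_X0] f_cont)
  moreover have "continuous_map (prod_topology (discrete_topology Y) (subtopology K X0))
      (subtopology K (F X0)) (\<lambda>(j, x). f j x)"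
    unfolding continuous_map_in_subtopology
    by (auto intro!: continuous_map_prod_discrete continuous_map_from_subtopology f_cont
        simp: hutchinson_def)
  moreover have "(\<lambda>(j, x). f j x) ` (Y \<times> X0) = F X0"
    by (auto simp: hutchinson_def)
  ultimately show ?thesis
    using compact_X0 K_Hausdorff X0_subset X0_subset_K F_X0
    by (auto simp: similarity_scheme_def sss_scheme_def compact_space_subtopology
        Hausdorff_space_subtopology Hausdorff_space_discrete_topology
        compact_space_discrete_topology continuous_map_in_subtopology Int_absorb1
        intro: continuous_map_from_subtopology)
qed

section \<open>The tower realised inside the space\<close>

definition faithful :: "nat \<Rightarrow> bool" where
  "faithful n \<longleftrightarrow> inj_on e (X n) \<and> e ` X n = (F ^^ n) X0 \<and>
     (\<forall>x\<in>X0. tphis \<S> n 0 (Pt0 x) \<in> X n \<and> e (tphis \<S> n 0 (Pt0 x)) = x)"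

lemma faithful_in_K: "faithful n \<Longrightarrow> z \<in> X n \<Longrightarrow> e z \<in> topspace K"
  using F_power_in_K[of n] unfolding faithful_def by blast

text \<open>The gluing relation becomes the kernel of \<open>(y, z)\<close> mapped to
  \<open>f y (e z)\<close>. This needs the last clause of \<open>faithful\<close>, since
  \<open>tsim\<close> glues only points that come from \<open>X0\<close> through
  \<open>tphis\<close>.\<close>

lemma tsim_eq:
  assumes "faithful n"
  shows "tsim \<S> n = {((y, z), (y', z')). y \<in> Y \<and> z \<in> X n \<and> y' \<in> Y \<and> z' \<in> X n
                        \<and> f y (e z) = f y' (e z')}" (is "_ = ?R")
proof (rule set_eqI, clarify)
  fix y z y' z'
  have "(y, z) = (y', z') \<or> (\<exists>x\<in>X0. \<exists>x'\<in>X0.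
            z = tphis \<S> n 0 (Pt0 x) \<and> z' = tphis \<S> n 0 (Pt0 x') \<and> f y x = f y' x')
        \<longleftrightarrow> f y (e z) = f y' (e z')" (is "?A \<longleftrightarrow> ?B")
    if pts: "y \<in> Y" "z \<in> X n" "y' \<in> Y" "z' \<in> X n"
  proof
    assume ?A
    then show ?B using assms unfolding faithful_def by auto
  next
    assume ?B
    then consider "y = y'" "e z = e z'" | "e z \<in> X0" "e z' \<in> X0"
      using f_eq_cases[OF pts(1,3) faithful_in_K[OF assms pts(2)] faithful_in_K[OF assms pts(4)]]
      by blast
    then show ?A
    proof cases
      case 1
      then show ?thesis using assms pts unfolding faithful_def by (auto dest: inj_onD)
    next
      case 2
      \<comment> \<open>Both sides have the same value under \<open>e\<close>, which is injective on
        \<open>X n\<close>.\<close>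
      have "w = tphis \<S> n 0 (Pt0 (e w))" if "w \<in> X n" "e w \<in> X0" for w
        using assms that unfolding faithful_def by (metis inj_onD)
      then show ?thesis using 2 pts \<open>?B\<close> by blast
    qed
  qed
  then show "((y, z), (y', z')) \<in> tsim \<S> n \<longleftrightarrow> ((y, z), (y', z')) \<in> ?R" by auto
qed

lemma tpi_facts:
  assumes "faithful n"
  shows e_tpi: "y \<in> Y \<Longrightarrow> z \<in> X n \<Longrightarrow> e (tpi \<S> n (y, z)) = f y (e z)"
    and tower_Suc: "X (Suc n) = tpi \<S> n ` (Y \<times> X n)"
    and inj_e_tower_Suc: "inj_on e (X (Suc n))"
proof -
  have "(\<forall>y\<in>Y. \<forall>z\<in>X n. e (tpi \<S> n (y, z)) = f y (e z)) \<and>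
    X (Suc n) = tpi \<S> n ` (Y \<times> X n) \<and> inj_on e (X (Suc n))"
  proof (cases n)
    \<comment> \<open>\<open>X 1\<close> is the given space \<open>F X0\<close> and not a quotient,
      so this level is checked directly.\<close>
    case 0
    have "Pt1 ` F X0 = tpi \<S> 0 ` (Y \<times> Pt0 ` X0)"
      by (force simp: hutchinson_def)
    then show ?thesis using 0 F_X0 by (auto simp: inj_on_def Int_commute)
  next
    case (Suc m)
    have eq: "equiv (Y \<times> X n) (tsim \<S> n)"
      unfolding tsim_eq[OF assms] by (auto simp: equiv_def refl_on_def sym_def trans_def)
    have ev: "e (tpi \<S> n (y, z)) = f y (e z)" if "y \<in> Y" "z \<in> X n" for y z
    proof -
      \<comment> \<open>\<open>q\<close> is the representative recorded by \<open>class_pt\<close>.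
        Being equivalent to \<open>(y, z)\<close>, it has the same value by \<open>tsim_eq\<close>,
        so the evaluation does not depend on the choice.\<close>
      define q where "q = (SOME q. q \<in> tsim \<S> n `` {(y, z)})"
      have "q \<in> tsim \<S> n `` {(y, z)}"
        unfolding q_def
        by (rule someI[of _ "(y, z)"]) (use that equiv_class_self[OF eq] in auto)
      then have "e (Cls q) = f y (e z)"
        by (auto simp: tsim_eq[OF assms] simp del: tsim.simps)
      then show ?thesis unfolding Suc q_def by (simp add: class_pt_def del: tsim.simps)
    qed
    have X: "X (Suc n) = tpi \<S> n ` (Y \<times> X n)" unfolding Suc by (simp del: tpi.simps)
    have glue: "tpi \<S> n (y, z) = tpi \<S> n (y', z')"
      if "y \<in> Y" "z \<in> X n" "y' \<in> Y" "z' \<in> X n" "f y (e z) = f y' (e z')" for y z y' z'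
    proof -
      have "((y, z), (y', z')) \<in> tsim \<S> n" unfolding tsim_eq[OF assms] using that by simp
      then show ?thesis using equiv_class_eq[OF eq] unfolding Suc by (simp del: tsim.simps)
    qed
    have "inj_on e (X (Suc n))"
    proof (rule inj_onI)
      fix v w assume "v \<in> X (Suc n)" "w \<in> X (Suc n)" and eq: "e v = e w"
      then obtain y z y' z' where *: "y \<in> Y" "z \<in> X n" "y' \<in> Y" "z' \<in> X n"
        and v: "v = tpi \<S> n (y, z)" and w: "w = tpi \<S> n (y', z')"
        unfolding X by blast
      then show "v = w" using eq unfolding v w by (intro glue) (simp_all only: ev)
    qed
    then show ?thesis using ev X by blast
  qed
  then show "y \<in> Y \<Longrightarrow> z \<in> X n \<Longrightarrow> e (tpi \<S> n (y, z)) = f y (e z)"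
    "X (Suc n) = tpi \<S> n ` (Y \<times> X n)" "inj_on e (X (Suc n))" by blast+
qed

lemma faithful_Suc:
  assumes "faithful n" and "\<And>z. z \<in> X n \<Longrightarrow> tphi \<S> n z \<in> X (Suc n) \<and> e (tphi \<S> n z) = e z"
  shows "faithful (Suc n)"
proof -
  have "e ` X (Suc n) = (\<Union>y\<in>Y. f y ` e ` X n)"
    unfolding tower_Suc[OF assms(1)] using e_tpi[OF assms(1)] by force
  then have "e ` X (Suc n) = (F ^^ Suc n) X0"
    using assms(1) by (simp add: faithful_def hutchinson_def)
  moreover have "tphis \<S> (Suc n) 0 (Pt0 x) \<in> X (Suc n) \<and> e (tphis \<S> (Suc n) 0 (Pt0 x)) = x"
    if "x \<in> X0" for x
    using assms that by (simp add: faithful_def)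
  ultimately show ?thesis using inj_e_tower_Suc[OF assms(1)] unfolding faithful_def by blast
qed

text \<open>The two claims need a joint induction: \<open>tphi\<close> is a definite description,
  whose well-definedness at level \<open>Suc n\<close> rests on the evaluation being injective two
  levels up, while faithfulness of the next level needs \<open>tphi\<close> to preserve
  values.\<close>

lemma faithful_and_tphi:
  "faithful n \<and> (\<forall>z\<in>X n. tphi \<S> n z \<in> X (Suc n) \<and> e (tphi \<S> n z) = e z)"
proof (induction n)
  case 0
  show ?case using X0_subset F_X0 by (auto simp: faithful_def inj_on_def image_image)
next
  case (Suc n)
  have F0: "faithful n" using Suc by blast
  have F1: "faithful (Suc n)" by (rule faithful_Suc) (use Suc in auto)
  have "tphi \<S> (Suc n) w \<in> X (Suc (Suc n)) \<and> e (tphi \<S> (Suc n) w) = e w"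
    if "w \<in> X (Suc n)" for w
  proof -
    \<comment> \<open>\<open>P\<close> is the property inside the \<open>THE\<close>. Every solution
      has the value \<open>e w\<close>, so injectivity of \<open>e\<close> gives uniqueness.\<close>
    define P where "P v \<longleftrightarrow> (\<exists>y\<in>Y. \<exists>x\<in>X n. w = tpi \<S> n (y, x) \<and>
      v = tpi \<S> (Suc n) (y, tphi \<S> n x))" for v
    have P: "v \<in> X (Suc (Suc n)) \<and> e v = e w" if v: "P v" for v
    proof -
      from v obtain y x where "y \<in> Y" "x \<in> X n" "w = tpi \<S> n (y, x)"
        "v = tpi \<S> (Suc n) (y, tphi \<S> n x)" unfolding P_def by blast
      moreover from this Suc have "tphi \<S> n x \<in> X (Suc n)" "e (tphi \<S> n x) = e x" by auto
      ultimately show ?thesis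
        using e_tpi[OF F1] e_tpi[OF F0] unfolding tower_Suc[OF F1]
        by (auto simp del: tpi.simps)
    qed
    have "\<exists>v. P v" using that unfolding P_def tower_Suc[OF F0] by blast
    moreover have "v = v'" if "P v" "P v'" for v v'
      using P[OF that(1)] P[OF that(2)] inj_e_tower_Suc[OF F1] by (metis inj_onD)
    ultimately have "P (THE v. P v)" by (metis theI)
    moreover have "tphi \<S> (Suc n) w = (THE v. P v)"
      unfolding P_def by (simp del: tpi.simps)
    ultimately show ?thesis using P by simp
  qed
  then show ?case using F1 by blast
qed

lemma faithful: "faithful n"
  and tphi_in: "z \<in> X n \<Longrightarrow> tphi \<S> n z \<in> X (Suc n)"
  and e_tphi: "z \<in> X n \<Longrightarrow> e (tphi \<S> n z) = e z"
  using faithful_and_tphi by blast+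

lemma inj_e: "inj_on e (X n)" and e_image: "e ` X n = (F ^^ n) X0"
  using faithful by (auto simp: faithful_def)

lemma e_in_K: "z \<in> X n \<Longrightarrow> e z \<in> topspace K"
  using faithful_in_K faithful by blast

lemma tpi_in: "y \<in> Y \<Longrightarrow> z \<in> X n \<Longrightarrow> tpi \<S> n (y, z) \<in> X (Suc n)"
  unfolding tower_Suc[OF faithful] by blast

lemma tphis_in: "z \<in> X n \<Longrightarrow> n \<le> p \<Longrightarrow> tphis \<S> p n z \<in> X p \<and> e (tphis \<S> p n z) = e z"
proof (induction p)
  case (Suc p)
  then show ?case
    by (cases "n \<le> p") (auto simp: tphi_in e_tphi le_Suc_eq simp del: tower.simps tphi.simps)
qed simp

lemma tpis_in:
  "u \<in> Seq \<Longrightarrow> z \<in> X q \<Longrightarrow>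
     tpis \<S> p q u z \<in> X (p + q) \<and> e (tpis \<S> p q u z) = word_map f p u (e z)"
proof (induction p arbitrary: q z)
  case (Suc p)
  have "u p \<in> Y" using Suc.prems(1) unfolding Seq_iff by blast
  then show ?case
    using Suc.IH[of "tpi \<S> q (u p, z)" "Suc q"] Suc.prems tpi_in e_tpi[OF faithful]
    by (simp del: tower.simps tpi.simps)
qed simp

section \<open>Word maps, cells and fibres\<close>

lemma word_map_in: "u \<in> Seq \<Longrightarrow> x \<in> topspace K \<Longrightarrow> word_map f p u x \<in> topspace K"
  by (induction p arbitrary: x) (auto simp: Seq_iff f_in)

lemma inj_on_word_map: "u \<in> Seq \<Longrightarrow> inj_on (word_map f p u) (topspace K)"
proof (induction p)
  case (Suc p)
  then have "u p \<in> Y" by (simp only: Seq_iff)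
  with Suc show ?case
    using f_inj[of "u p"] f_in[of "u p"] by (simp add: inj_on_def)
qed (simp add: inj_on_def)

lemma word_map_in_F_power: "u \<in> Seq \<Longrightarrow> x \<in> C \<Longrightarrow> word_map f p u x \<in> (F ^^ p) C"
proof (induction p arbitrary: u)
  case (Suc p)
  have "u 0 \<in> Y" "(\<lambda>i. u (Suc i)) \<in> Seq" using Suc.prems by (simp_all only: Seq_iff) blast
  then show ?case
    using Suc unfolding word_map_Suc_shift by (auto simp: F_iff)
qed simp

text \<open>Comparing outermost letters by \<open>f_eq_cases\<close>, the inner point either matches
  a point of the previous iterate or lies in \<open>X0\<close>, which is contained in every iterate.
  So a point of the \<open>p\<close>-th iterate reached by the word \<open>u\<close> already lies in
  the image of \<open>X0\<close> under that word.\<close>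

lemma word_map_F_power_D:
  "u \<in> Seq \<Longrightarrow> a \<in> topspace K \<Longrightarrow> word_map f p u a \<in> (F ^^ p) X0 \<Longrightarrow> a \<in> X0"
proof (induction p arbitrary: u)
  case (Suc p)
  let ?u = "\<lambda>i. u (Suc i)"
  have u: "u 0 \<in> Y" "?u \<in> Seq" using Suc.prems(1) by (simp_all only: Seq_iff) blast
  obtain y x where "y \<in> Y" "x \<in> (F ^^ p) X0" "f (u 0) (word_map f p ?u a) = f y x"
    using Suc.prems(3) unfolding word_map_Suc_shift by (auto simp: F_iff)
  then have "word_map f p ?u a \<in> (F ^^ p) X0"
    using f_eq_cases[of "u 0" y "word_map f p ?u a" x] u Suc.prems(2)
      F_power_in_K[of p] X0_subset_F_power[of p] word_map_in by blast
  then show ?case using Suc.IH u Suc.prems(2) by blast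
qed simp

lemma piK_word_map: "u \<in> Seq \<Longrightarrow> \<pi>K u = word_map f p u (\<pi>K (\<lambda>i. u (p + i)))"
proof (induction p)
  case (Suc p)
  have "(\<lambda>i. u (p + i)) = case_nat (u p) (\<lambda>i. u (Suc p + i))"
    by (auto simp: fun_eq_iff split: nat.split)
  moreover have "u p \<in> Y" "(\<lambda>i. u (Suc p + i)) \<in> Seq"
    using Suc.prems by (simp_all only: Seq_iff) blast
  ultimately have "\<pi>K (\<lambda>i. u (p + i)) = f (u p) (\<pi>K (\<lambda>i. u (Suc p + i)))"
    using piK_case_nat by simp
  then show ?case using Suc by simp
qed simp

text \<open>Since \<open>e\<close> is injective on \<open>X p\<close>, which contains the cell,
  membership can be tested after evaluation.\<close>

lemma cell_eq: "u \<in> Seq \<Longrightarrow> z \<in> X p \<Longrightarrow> z \<in> cell \<S> p u \<longleftrightarrow> e z \<in> word_map f p u ` X0"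
proof -
  assume u: "u \<in> Seq" and z: "z \<in> X p"
  have "cell \<S> p u \<subseteq> X p" "e ` cell \<S> p u = word_map f p u ` e ` X 0"
    using tpis_in[OF u, of _ 0 p] by (auto simp: cell_def image_image simp del: tower.simps)
  moreover have "e ` X 0 = X0" using e_image[of 0] by simp
  ultimately show ?thesis using inj_on_image_mem_iff[OF inj_e z] by metis
qed

text \<open>A topological substitute for shrinking cells: \<open>x\<close> has addresses sharing
  ever longer prefixes with \<open>u\<close>. They converge to \<open>u\<close> while their image
  stays \<open>x\<close>, so continuity of \<open>\<pi>K\<close> and the Hausdorff property force
  the equality.\<close>

lemma piK_eqI_prefixes:
  assumes u: "u \<in> Seq" and x: "\<And>p. p \<ge> n \<Longrightarrow> x \<in> word_map f p u ` topspace K"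
  shows "\<pi>K u = x"
proof -
  have "\<exists>v. v \<in> Seq \<and> (\<forall>i<p. v i = u i) \<and> \<pi>K v = x" for p
  proof -
    \<comment> \<open>The hypothesis holds only for lengths from \<open>n\<close> on; the length
      \<open>max n p\<close> still covers the first \<open>p\<close> letters.\<close>
    obtain a where a: "a \<in> topspace K" "x = word_map f (max n p) u a"
      using x[of "max n p"] by auto
    then obtain w where w: "w \<in> Seq" "a = \<pi>K w" using piK_surj by blast
    \<comment> \<open>An address of \<open>x\<close>: the prefix of \<open>u\<close> followed by an
      address of \<open>a\<close>.\<close>
    define v where "v i = (if i < max n p then u i else w (i - max n p))" for i
    have v: "v \<in> Seq" using u w unfolding Seq_iff v_def by simp
    have "\<pi>K v = word_map f (max n p) v (\<pi>K w)"
      using piK_word_map[OF v, of "max n p"] by (simp add: v_def)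
    also have "\<dots> = x" unfolding a w(2) by (rule word_map_cong) (simp add: v_def)
    finally show ?thesis using v by (intro exI[of _ v]) (auto simp: v_def)
  qed
  then obtain v where v: "\<And>p. v p \<in> Seq" "\<And>p i. i < p \<Longrightarrow> v p i = u i" "\<And>p. \<pi>K (v p) = x"
    by metis
  have "limitin K (\<pi>K \<circ> v) (\<pi>K u) sequentially"
    by (rule continuous_map_limit[OF piK_cont])
      (rule limitin_seq_space_agreeing_prefixes[OF u v(1,2)])
  then have "limitin K (\<lambda>_. x) (\<pi>K u) sequentially" by (simp add: comp_def v(3))
  moreover have "limitin K (\<lambda>_. x) x sequentially"
    using piK_in[OF v(1)] v(3) by (simp add: limitin_const_iff[OF Hausdorff_imp_t1_space[OF K_Hausdorff]])
  ultimately show ?thesis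
    by (rule limitin_Hausdorff_unique) (simp_all add: K_Hausdorff)
qed

lemma Gam_eq:
  assumes z: "z \<in> X n"
  shows "Gam \<S> n z = {u \<in> Seq. \<pi>K u = e z}"
proof -
  have "(\<forall>p\<ge>n. e z \<in> word_map f p u ` X0) \<longleftrightarrow> \<pi>K u = e z" if u: "u \<in> Seq" for u
  proof
    assume "\<forall>p\<ge>n. e z \<in> word_map f p u ` X0"
    then show "\<pi>K u = e z" using X0_subset_K by (intro piK_eqI_prefixes[OF u]) blast
  next
    assume eq: "\<pi>K u = e z"
    show "\<forall>p\<ge>n. e z \<in> word_map f p u ` X0"
    proof (intro allI impI)
      fix p assume "n \<le> p"
      \<comment> \<open>Moving \<open>z\<close> up the tower keeps its value, so this value lies in
        all later iterates.\<close>
      then have "e z \<in> (F ^^ p) X0" using tphis_in[OF z] e_image by (metis imageI)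
      moreover have s: "(\<lambda>i. u (p + i)) \<in> Seq" using u by (simp only: Seq_iff) blast
      ultimately have "\<pi>K (\<lambda>i. u (p + i)) \<in> X0"
        using word_map_F_power_D[OF u piK_in[OF s]] piK_word_map[OF u, of p] eq by metis
      then show "e z \<in> word_map f p u ` X0" using piK_word_map[OF u, of p] eq by auto
    qed
  qed
  moreover have "(\<forall>p\<ge>n. tphis \<S> p n z \<in> cell \<S> p u) \<longleftrightarrow> (\<forall>p\<ge>n. e z \<in> word_map f p u ` X0)"
    if "u \<in> Seq" for u
    using cell_eq[OF that] tphis_in[OF z] by metis
  ultimately show ?thesis unfolding Gam_def by auto
qed

section \<open>The relation, full injectivity and the limit space\<close>

lemma common_point_in_F_power:
  assumes "u \<in> Seq" "v \<in> Seq" "\<pi>K u = \<pi>K v" "u \<noteq> v"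
  shows "\<exists>n. \<pi>K u \<in> (F ^^ n) X0"
proof -
  define p where "p = (LEAST i. u i \<noteq> v i)"
  obtain i where "u i \<noteq> v i" using assms(4) by blast
  then have p: "u p \<noteq> v p" unfolding p_def by (rule LeastI)
  have pre: "v i = u i" if "i < p" for i
    using not_less_Least[of i "\<lambda>i. u i \<noteq> v i"] that unfolding p_def by simp
  have Y: "u p \<in> Y" "v p \<in> Y" using assms(1,2) unfolding Seq_iff by blast+
  define a b where "a = \<pi>K (\<lambda>i. u (Suc p + i))" and "b = \<pi>K (\<lambda>i. v (Suc p + i))"
  have ab: "a \<in> topspace K" "b \<in> topspace K"
    unfolding a_def b_def using assms(1,2) by (auto intro!: piK_in simp only: Seq_iff)
  have u: "\<pi>K u = word_map f p u (f (u p) a)" unfolding a_def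
    using piK_word_map[OF assms(1), of "Suc p"] by simp
  have "\<pi>K v = word_map f p v (f (v p) b)" unfolding b_def
    using piK_word_map[OF assms(2), of "Suc p"] by simp
  then have "word_map f p u (f (u p) a) = word_map f p u (f (v p) b)"
    using u assms(3) word_map_cong[of p v u, OF pre] by metis
  \<comment> \<open>The common prefix acts injectively and can be cancelled.\<close>
  then have "f (u p) a = f (v p) b"
    using inj_on_word_map[OF assms(1)] f_in Y ab by (metis inj_onD)
  \<comment> \<open>The letters at \<open>p\<close> differ, which leaves only the second
    alternative. Restoring the \<open>Suc p\<close> letters before \<open>a\<close> then lands in
    the iterate of that order.\<close>
  then have "a \<in> X0" using f_eq_cases Y ab p by blast
  then have "word_map f (Suc p) u a \<in> (F ^^ Suc p) X0" by (rule word_map_in_F_power[OF assms(1)])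
  then have "\<pi>K u \<in> (F ^^ Suc p) X0" unfolding u by simp
  then show ?thesis ..
qed

lemma scheme_rel_eq: "scheme_rel \<S> = {(u, v). u \<in> Seq \<and> v \<in> Seq \<and> \<pi>K u = \<pi>K v}"
proof -
  have "u = v \<or> (\<exists>n. \<exists>z\<in>X n. u \<in> Gam \<S> n z \<and> v \<in> Gam \<S> n z) \<longleftrightarrow> \<pi>K u = \<pi>K v"
    if u: "u \<in> Seq" and v: "v \<in> Seq" for u v
  proof
    assume eq: "\<pi>K u = \<pi>K v"
    \<comment> \<open>Only distinct sequences are treated: a point with a single address need not
      lie in any iterate, and its pair falls under the clause \<open>u = v\<close>.\<close>
    have "\<exists>n. \<exists>z\<in>X n. u \<in> Gam \<S> n z \<and> v \<in> Gam \<S> n z" if "u \<noteq> v"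
    proof -
      from that obtain n where "\<pi>K u \<in> (F ^^ n) X0" using common_point_in_F_power[OF u v eq] by blast
      then obtain z where "z \<in> X n" "e z = \<pi>K u" unfolding e_image[symmetric] by force
      then show "\<exists>n. \<exists>z\<in>X n. u \<in> Gam \<S> n z \<and> v \<in> Gam \<S> n z"
        using Gam_eq u v eq by (metis (mono_tags, lifting) mem_Collect_eq)
    qed
    then show "u = v \<or> (\<exists>n. \<exists>z\<in>X n. u \<in> Gam \<S> n z \<and> v \<in> Gam \<S> n z)" by blast
  qed (use Gam_eq in auto)
  then show ?thesis unfolding scheme_rel_def scheme_simps by blast
qed

text \<open>The relation is the kernel of \<open>\<pi>K\<close>, hence already the least equivalence
  relation containing itself.\<close>

lemma scheme_rel_inf_eq: "scheme_rel_inf \<S> = scheme_rel \<S>"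
proof -
  have "equiv Seq (scheme_rel \<S>)"
    unfolding scheme_rel_eq by (auto simp: equiv_def refl_on_def sym_def trans_def)
  then show ?thesis unfolding scheme_rel_inf_def scheme_simps by blast
qed

lemma pi_seq_eq: "u \<in> Seq \<Longrightarrow> pi_seq \<S> u = {v \<in> Seq. \<pi>K v = \<pi>K u}"
  unfolding pi_seq_def scheme_rel_inf_eq scheme_rel_eq by auto

lemma phi_inf_eq:
  assumes "z \<in> X n"
  shows "phi_inf \<S> n z = {v \<in> Seq. \<pi>K v = e z}"
proof -
  \<comment> \<open>Surjectivity of \<open>\<pi>K\<close> makes the fibre nonempty, so
    \<open>the_elem\<close> is applied to a genuine singleton.\<close>
  obtain u where u: "u \<in> Seq" "\<pi>K u = e z" using e_in_K[OF assms] piK_surj by force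
  have "pi_seq \<S> ` Gam \<S> n z = {{v \<in> Seq. \<pi>K v = e z}}"
    unfolding Gam_eq[OF assms] using u pi_seq_eq by auto
  then show ?thesis unfolding phi_inf_def by simp
qed

lemma scheme_fully_injective: "fully_injective \<S>"
  unfolding fully_injective_def
proof (intro allI inj_onI)
  fix n z z' assume z: "z \<in> X n" "z' \<in> X n" and eq: "phi_inf \<S> n z = phi_inf \<S> n z'"
  obtain u where "u \<in> Seq" "\<pi>K u = e z" using e_in_K[OF z(1)] piK_surj by force
  then have "u \<in> phi_inf \<S> n z'" unfolding eq[symmetric] phi_inf_eq[OF z(1)] by blast
  then have "e z = e z'" using \<open>\<pi>K u = e z\<close> unfolding phi_inf_eq[OF z(2)] by simp
  then show "z = z'" using inj_e z by (metis inj_onD)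
qed

text \<open>The induced map is a continuous bijection from a compact space onto a Hausdorff
  space.\<close>

lemma X_inf_homeomorphic:
  "\<exists>h. homeomorphic_map (X_inf \<S>) K h \<and> (\<forall>u\<in>Seq. h (pi_seq \<S> u) = \<pi>K u)"
proof -
  \<comment> \<open>Any representative will do, because \<open>\<pi>K\<close> is constant on each
    class.\<close>
  define h where "h c = \<pi>K (SOME u. u \<in> c)" for c
  have h: "h (pi_seq \<S> u) = \<pi>K u" if "u \<in> Seq" for u
  proof -
    have "(SOME v. v \<in> pi_seq \<S> u) \<in> pi_seq \<S> u"
      by (rule someI[of _ u]) (use that pi_seq_eq in auto)
    then show ?thesis unfolding h_def using pi_seq_eq[OF that] by auto
  qed
  have q: "quotient_map (seq_space (discrete_topology Y)) (X_inf \<S>) (pi_seq \<S>)"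
    unfolding X_inf_def scheme_simps by (rule quotient_map_quotient_topology)
  have top: "topspace (X_inf \<S>) = pi_seq \<S> ` Seq"
    using quotient_imp_surjective_map[OF q] by simp
  have "compact_space (seq_space (discrete_topology Y))"
    by (simp add: seq_space_def compact_space_product_topology compact_space_discrete_topology)
  then have "compact_space (X_inf \<S>)"
    using compact_space_def image_compactin quotient_imp_continuous_map[OF q] top by metis
  \<comment> \<open>By the universal property of the quotient, it suffices that \<open>h\<close>
    composed with \<open>pi_seq\<close> agrees with the continuous map
    \<open>\<pi>K\<close>.\<close>
  moreover have "continuous_map (X_inf \<S>) K h"
    using continuous_map_eq[OF piK_cont, of "h \<circ> pi_seq \<S>"] h
    unfolding continuous_compose_quotient_map_eq[OF q] by simp
  moreover have "h ` topspace (X_inf \<S>) = topspace K"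
    unfolding top image_image piK_surj[symmetric] using h by (intro image_cong) auto
  moreover have "inj_on h (topspace (X_inf \<S>))"
    unfolding top using h pi_seq_eq by (auto simp: inj_on_def)
  ultimately have "homeomorphic_map (X_inf \<S>) K h"
    using K_Hausdorff by (intro continuous_imp_homeomorphic_map)
  then show ?thesis using h by blast
qed

end

theorem theorem6p8:
  fixes K :: "'k topology" and N :: nat and f :: "nat \<Rightarrow> 'k \<Rightarrow> 'k"
    and \<pi>K :: "(nat \<Rightarrow> nat) \<Rightarrow> 'k" and X0 :: "'k set"
  assumes sss: "self_similar_structure K N f \<pi>K"
    and A: "X0 \<noteq> {}" "compactin K X0"
    and B: "overlap_set K N f \<subseteq> X0"
    and C: "X0 \<subseteq> hutchinson N f X0"
  shows "similarity_scheme (sss_scheme K N f X0) \<and>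
         scheme_rel (sss_scheme K N f X0) =
           {(I, J). I \<in> topspace (seq_space (discrete_topology {1..N})) \<and>
                    J \<in> topspace (seq_space (discrete_topology {1..N})) \<and> \<pi>K I = \<pi>K J} \<and>
         fully_injective (sss_scheme K N f X0) \<and>
         (\<exists>h. homeomorphic_map (X_inf (sss_scheme K N f X0)) K h \<and>
              (\<forall>I\<in>topspace (seq_space (discrete_topology {1..N})).
                 h (pi_seq (sss_scheme K N f X0) I) = \<pi>K I))"
proof -
  interpret sss_tower K N f \<pi>K X0 by (rule sss_tower.intro) (rule sss A(2) B C)+
  show ?thesis
    by (rule conjI[OF scheme_similarity conjI[OF scheme_rel_eq
          conjI[OF scheme_fully_injective X_inf_homeomorphic]]])
qed

end
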